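(* Let $f\colon\mathbb{R}^n\to\overline{\mathbb{R}}$ be a proper convex function. For each $v\in\mathbb{R}^n$ let $f_v(x)=f(x)-\langle v,x\rangle$ for $x\in\mathbb{R}^n$. Then for all $v$ in a subset of $\mathbb{R}^n$ of full Lebesgue measure (i.e. for all $v$ outside a Lebesgue null set), the function $f_v$ has at most one minimizer over $\mathbb{R}^n$, and this minimizer, if it exists, is nondegenerate, meaning that the minimizer $x$ satisfies $0\in\operatorname{ri}\partial f_v(x)$.
   Context: $\overline{\mathbb{R}}=\mathbb{R}\cup\{-\infty,+\infty\}$. A function $f\colon\mathbb{R}^n\to\overline{\mathbb{R}}$ is proper if it never takes the value $-\infty$ and is not identically $+\infty$; it is convex if its epigraph $\{(x,r)\in\mathbb{R}^n\times\mathbb{R}: r\ge f(x)\}$ is a convex set. No closedness (lower semicontinuity) is assumed. The subdifferential of a convex function $g$ at a point $\bar x$ where $g$ is finite is $\partial g(\bar x)=\{w\in\mathbb{R}^n:\langle w,x-\bar x\rangle\le g(x)-g(\bar x)\text{ for all }x\in\mathbb{R}^n\}$; if $g(\bar x)$ is not finite, $\partial g(\bar x)=\emptyset$. For a convex set $S\subset\mathbb{R}^n$, $\operatorname{ri}S$ denotes its relative interior (interior relative to its affine hull). *)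

theory Defs
  imports "HOL-Analysis.Analysis"
begin

definition proper_fun :: "('a \<Rightarrow> ereal) \<Rightarrow> bool" where
  "proper_fun f \<longleftrightarrow> (\<forall>x. f x \<noteq> -\<infinity>) \<and> (\<exists>x. f x \<noteq> \<infinity>)"

(* The library's epigraph is for real-valued functions only.  The heights r are real, so
   points where f is +infinity contribute nothing. *)
definition ereal_epigraph :: "('a \<Rightarrow> ereal) \<Rightarrow> ('a \<times> real) set" where
  "ereal_epigraph f = {(x, r). f x \<le> ereal r}"

definition convex_fun :: "('a::real_vector \<Rightarrow> ereal) \<Rightarrow> bool" where
  "convex_fun f \<longleftrightarrow> convex (ereal_epigraph f)"

(* Since g a is finite in the relevant branch, the ereal difference g x - g a is never of
   the form infinity - infinity. *)
definition subdifferential :: "('a::real_inner \<Rightarrow> ereal) \<Rightarrow> 'a \<Rightarrow> 'a set" where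
  "subdifferential g a =
     (if \<bar>g a\<bar> = \<infinity> then {} else {w. \<forall>x. ereal (inner w (x - a)) \<le> g x - g a})"

definition tilt :: "('a::real_inner \<Rightarrow> ereal) \<Rightarrow> 'a \<Rightarrow> 'a \<Rightarrow> ereal" where
  "tilt f v x = f x - ereal (inner v x)"

definition minimizer :: "('a \<Rightarrow> ereal) \<Rightarrow> 'a \<Rightarrow> bool" where
  "minimizer f x \<longleftrightarrow> is_arg_min f (\<lambda>_. True) x"

definition nondegenerate_at :: "('a::euclidean_space \<Rightarrow> ereal) \<Rightarrow> 'a \<Rightarrow> bool" where
  "nondegenerate_at f x \<longleftrightarrow> 0 \<in> rel_interior (subdifferential f x)"

end

theory Submission
  imports Defs
begin

text \<open>
Write \<open>h\<close> for the convex conjugate of \<open>f\<close> and \<open>H\<close> for its epigraph, a closed convex set.  A point \<open>x\<close>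
minimizes the tilted function \<open>f\<^sub>v\<close> exactly if \<open>f x\<close> is finite and \<open>(v, \<langle>v,x\<rangle> - f x)\<close> lies in the
exposed face of \<open>H\<close> on which the linear functional \<open>(v, s) \<mapsto> \<langle>x,v\<rangle> - s\<close> is maximal, and then the
projection of that face to the \<open>v\<close>-space, its shadow, is the subdifferential of \<open>f\<close> at \<open>x\<close>
(lemmas \<open>minimizer_tiltD\<close> and \<open>subdifferential_tilt_eq\<close>).  So two statements about the lower faces
of a closed convex set \<open>H\<close> are needed: almost no \<open>v\<close> lies below a point that belongs to the faces of
two different slopes \<open>x\<close> (\<open>negligible_two_slopes\<close>), and almost no \<open>v\<close> lies in the relative boundary of
the shadow of a face (\<open>negligible_relative_boundaries_of_lower_faces\<close>, a result in the spirit of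
Larman's theorem on the relative boundaries of the faces of a convex body).

Both rest on one measure-theoretic principle, \<open>negligible_if_disjoint_copies_nearby\<close>: a compact set
\<open>Z\<close> is null as soon as every neighbourhood of \<open>Z\<close> contains a set disjoint from \<open>Z\<close> whose measure is
at least a fixed fraction of that of \<open>Z\<close>.

For two slopes, let \<open>Z\<close> consist of points that have a slope with \<open>u\<close>-component at most \<open>\<alpha>\<close> and another
one with \<open>u\<close>-component at least \<open>\<beta> > \<alpha>\<close>.  By monotonicity of the slopes, small translates of \<open>Z\<close> in
direction \<open>u\<close> are disjoint from \<open>Z\<close>.

For relative boundaries, push the boundary points slightly into their faces: replace \<open>z\<close> by
\<open>(1 - \<eta>) z + \<eta> c(z)\<close>, where \<open>c(z)\<close> is a relatively interior point of the face above \<open>z\<close>.  The result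
is no longer a boundary point, so the pushed set is disjoint from the original one.  What must be
excluded is that pushing shrinks the measure too much.  To this end \<open>c(z)\<close> is only chosen
approximately, from a finite set \<open>G\<close>: for slope \<open>x\<close>, take a point of \<open>G\<close> at which the functional
of slope \<open>x\<close> is largest.  Then the pushing map is a homothety with ratio \<open>1 - \<eta>\<close> on each of finitely
many pieces, and the images of the pieces are disjoint, because a coincidence of two images forces
the two slopes to agree (\<open>lower_face_if_same_combination\<close>).  Hence the measure is multiplied by exactly
\<open>(1 - \<eta>)^n\<close> (\<open>negligible_nonextendable\<close>).  By compactness, a sufficiently fine \<open>G\<close> still pushes \<open>Z\<close>
off itself.  Countably many choices of the region that contains \<open>G\<close> capture all boundary points.
\<close>

section \<open>Criteria for null sets\<close>

text \<open>Choose an open set around \<open>Z\<close> whose excess over \<open>Z\<close> has measure less than \<open>c\<close> times the measure of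
\<open>Z\<close>: the copy inside a neighbourhood that fits into this open set does not find enough room.\<close>

lemma negligible_if_disjoint_copies_nearby:
  fixes Z :: "'a::euclidean_space set"
  assumes Z: "compact Z" and "c > 0"
    and copies: "\<And>d. d > 0 \<Longrightarrow> \<exists>Y\<in>lmeasurable. Y \<inter> Z = {} \<and> Y \<subseteq> (\<Union>z\<in>Z. ball z d)
                   \<and> c * measure lebesgue Z \<le> measure lebesgue Y"
  shows "negligible Z"
proof (rule ccontr)
  assume "\<not> negligible Z"
  have mZ: "Z \<in> lmeasurable"
    by (simp add: Z lmeasurable_compact)
  then have pos: "measure lebesgue Z > 0"
    using \<open>\<not> negligible Z\<close> negligible_iff_measure0 zero_less_measure_iff by blast
  define e where "e = c * measure lebesgue Z"
  have "e > 0"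
    using pos \<open>c > 0\<close> by (simp add: e_def)
  then obtain T where T: "open T" "Z \<subseteq> T" "T - Z \<in> lmeasurable" "emeasure lebesgue (T - Z) < ennreal e"
    using sets_lebesgue_outer_open[OF fmeasurableD[OF mZ]] by blast
  obtain d where d: "d > 0" "(\<Union>z\<in>Z. ball z d) \<subseteq> T"
    using compact_subset_open_imp_ball_epsilon_subset[OF Z T(1,2)] by metis
  obtain Y where Y: "Y \<in> lmeasurable" "Y \<inter> Z = {}" "Y \<subseteq> (\<Union>z\<in>Z. ball z d)" "e \<le> measure lebesgue Y"
    using copies[OF d(1)] e_def by blast
  have "measure lebesgue Y \<le> measure lebesgue (T - Z)"
    using Y T d by (intro measure_mono_fmeasurable) (auto simp: fmeasurableD)
  also have "\<dots> < e"
    using T(3,4) \<open>e > 0\<close> by (simp add: emeasure_eq_measure2 ennreal_less_iff)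
  finally show False
    using Y(4) by simp
qed

lemma negligible_if_compact_subsets_negligible:
  fixes S :: "'a::euclidean_space set"
  assumes S: "S \<in> sets lebesgue" and cpt: "\<And>Z. compact Z \<Longrightarrow> Z \<subseteq> S \<Longrightarrow> negligible Z"
  shows "negligible S"
proof -
  obtain C T where CT: "fsigma C" "T \<in> null_sets lebesgue" "C \<union> T = S"
    using lebesgue_set_almost_fsigma[OF S] by metis
  then obtain F :: "nat \<Rightarrow> 'a set" where F: "range F \<subseteq> Collect compact" "C = \<Union> (range F)"
    using fsigma_Union_compact by blast
  have "negligible (F n)" for n
    using F CT(3) by (intro cpt) auto
  then have "negligible C"
    unfolding F(2) by (intro negligible_countable_Union) auto
  moreover have "negligible T"
    using CT(2) by (simp add: negligible_iff_null_sets)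
  ultimately show ?thesis
    using CT(3) negligible_Un by blast
qed

text \<open>The image is a countable union of compact sets.  All exceptional sets below are obtained from
closed sets by forgetting auxiliary coordinates, and this is what makes them measurable.\<close>

lemma borel_continuous_image_closed:
  fixes S :: "'a::euclidean_space set" and g :: "'a \<Rightarrow> 'b::euclidean_space"
  assumes "closed S" "continuous_on UNIV g"
  shows "g ` S \<in> sets borel"
proof -
  have "g ` S = (\<Union>n::nat. g ` (S \<inter> cball 0 (real n)))"
  proof (intro subset_antisym subsetI)
    fix y assume "y \<in> g ` S"
    then obtain x where "x \<in> S" "y = g x"
      by blast
    moreover obtain n :: nat where "norm x \<le> real n"
      using real_arch_simple by blast
    ultimately show "y \<in> (\<Union>n::nat. g ` (S \<inter> cball 0 (real n)))"
      by (intro UN_I[of n] UNIV_I) simp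
  qed auto
  moreover have "compact (g ` (S \<inter> cball 0 (real n)))" for n
    using assms by (intro compact_continuous_image closed_Int_compact)
      (auto intro: continuous_on_subset)
  then have "(\<Union>n::nat. g ` (S \<inter> cball 0 (real n))) \<in> sets borel"
    by (intro sets.countable_UN) (auto simp: borel_compact)
  ultimately show ?thesis
    by simp
qed

section \<open>Lower faces\<close>

text \<open>The linear functional with coefficient vector \<open>(x, -1)\<close>.  If \<open>H\<close> is the epigraph of a convex function
\<open>h\<close>, then maximizing it over \<open>H\<close> means minimizing \<open>h\<close> minus the linear function with slope \<open>x\<close>; the
maximizers form the part of the graph of \<open>h\<close> above the points with subgradient \<open>x\<close>.\<close>

definition slope_fun :: "'a::euclidean_space \<Rightarrow> 'a \<times> real \<Rightarrow> real" where
  "slope_fun x q = inner x (fst q) - snd q"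

definition lower_face :: "('a::euclidean_space \<times> real) set \<Rightarrow> 'a \<Rightarrow> ('a \<times> real) set" where
  "lower_face H x = {p \<in> H. \<forall>q\<in>H. slope_fun x q \<le> slope_fun x p}"

lemma slope_fun_add: "slope_fun x (p + q) = slope_fun x p + slope_fun x q"
  and slope_fun_diff: "slope_fun x (p - q) = slope_fun x p - slope_fun x q"
  and slope_fun_scaleR: "slope_fun x (a *\<^sub>R p) = a * slope_fun x p"
  by (simp_all add: slope_fun_def algebra_simps)

lemmas slope_fun_linear = slope_fun_add slope_fun_diff slope_fun_scaleR

lemma continuous_on_slope_fun [continuous_intros]:
  assumes "continuous_on S f" "continuous_on S g"
  shows "continuous_on S (\<lambda>z. slope_fun (f z) (g z))"
  unfolding slope_fun_def by (intro continuous_intros assms)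

lemma slope_fun_lipschitz: "\<bar>slope_fun x p - slope_fun x q\<bar> \<le> (norm x + 1) * dist p q"
proof -
  have "slope_fun x p - slope_fun x q = inner x (fst (p - q)) - snd (p - q)"
    by (simp add: slope_fun_def algebra_simps)
  also have "\<bar>\<dots>\<bar> \<le> \<bar>inner x (fst (p - q))\<bar> + \<bar>snd (p - q)\<bar>"
    by simp
  also have "\<dots> \<le> norm x * norm (p - q) + norm (p - q)"
  proof (intro add_mono)
    have "\<bar>inner x (fst (p - q))\<bar> \<le> norm x * norm (fst (p - q))"
      by (rule Cauchy_Schwarz_ineq2)
    also have "\<dots> \<le> norm x * norm (p - q)"
      using norm_fst_le[of "fst (p - q)" "snd (p - q)"]
      by (intro mult_left_mono) (simp_all only: prod.collapse norm_ge_zero)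
    finally show "\<bar>inner x (fst (p - q))\<bar> \<le> norm x * norm (p - q)" .
    show "\<bar>snd (p - q)\<bar> \<le> norm (p - q)"
      using norm_snd_le[of "snd (p - q)" "fst (p - q)"] by (simp only: prod.collapse real_norm_def)
  qed
  finally show ?thesis
    by (simp add: dist_norm algebra_simps)
qed

lemma lower_face_if_slope_fun_eq:
  assumes "p \<in> lower_face H x" "q \<in> H" "slope_fun x q = slope_fun x p"
  shows "q \<in> lower_face H x"
  using assms by (auto simp: lower_face_def)

lemma lower_face_slope_fun_eq: "p \<in> lower_face H x \<Longrightarrow> q \<in> lower_face H x \<Longrightarrow> slope_fun x p = slope_fun x q"
  by (force simp: lower_face_def)

lemma convex_lower_face:
  assumes "convex H" shows "convex (lower_face H x)"
proof (rule convexI)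
  fix p q and u v :: real
  assume *: "p \<in> lower_face H x" "q \<in> lower_face H x" "0 \<le> u" "0 \<le> v" "u + v = 1"
  have "u *\<^sub>R p + v *\<^sub>R q \<in> H"
    using * assms by (intro convexD) (auto simp: lower_face_def)
  moreover have "slope_fun x (u *\<^sub>R p + v *\<^sub>R q) = slope_fun x p"
  proof -
    have "slope_fun x (u *\<^sub>R p + v *\<^sub>R q) = (u + v) * slope_fun x p"
      using lower_face_slope_fun_eq[OF *(1,2)] by (simp only: slope_fun_linear distrib_right)
    then show ?thesis
      using *(5) by simp
  qed
  ultimately show "u *\<^sub>R p + v *\<^sub>R q \<in> lower_face H x"
    using lower_face_if_slope_fun_eq *(1) by blast
qed

text \<open>A lower face can only contain the lowest point of \<open>H\<close> on a vertical line.\<close>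

lemma lower_face_over_same_point:
  assumes "p \<in> lower_face H x" "p' \<in> lower_face H x'" "fst p = fst p'"
  shows "p = p'"
proof -
  have "slope_fun x p' \<le> slope_fun x p" "slope_fun x' p \<le> slope_fun x' p'"
    using assms by (auto simp: lower_face_def)
  then show ?thesis
    using assms(3) by (auto simp: slope_fun_def prod_eq_iff)
qed

lemma closed_lower_face_graph:
  fixes H :: "('a::euclidean_space \<times> real) set"
  assumes "closed H"
  shows "closed {(p, x). p \<in> lower_face H x}"
proof -
  have "{(p, x). p \<in> lower_face H x} = (H \<times> UNIV) \<inter> (\<Inter>q\<in>H. {z. slope_fun (snd z) q \<le> slope_fun (snd z) (fst z)})"
    by (auto simp: lower_face_def)
  also have "closed \<dots>"
    by (intro closed_Int closed_INT ballI closed_Times assms closed_UNIV closed_Collect_le continuous_intros)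
  finally show ?thesis .
qed

lemma closed_Collect_lower_face:
  fixes H :: "('a::euclidean_space \<times> real) set"
  assumes "closed H" "continuous_on UNIV f" "continuous_on UNIV g"
  shows "closed {z::'b::topological_space. f z \<in> lower_face H (g z)}"
proof -
  have "closed ((\<lambda>z. (f z, g z)) -` {(p, x). p \<in> lower_face H x})"
    using assms by (intro closed_vimage closed_lower_face_graph continuous_on_Pair)
  then show ?thesis
    by (simp add: vimage_def)
qed

section \<open>Points with two slopes\<close>

text \<open>Monotonicity of the subdifferential of a convex function.\<close>

lemma slope_mono:
  assumes "p \<in> lower_face H x" "p' \<in> lower_face H x'"
  shows "0 \<le> inner (x' - x) (fst p' - fst p)"
proof -
  have "slope_fun x p' \<le> slope_fun x p" "slope_fun x' p \<le> slope_fun x' p'"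
    using assms by (auto simp: lower_face_def)
  then show ?thesis
    by (simp add: slope_fun_def inner_diff)
qed

text \<open>Suppose that \<open>v\<close> and \<open>v + t u\<close>, with \<open>t > 0\<close>, both belong to the set.  By monotonicity, every slope
at \<open>v\<close> has at most the \<open>u\<close>-component of every slope at \<open>v + t u\<close>, so \<open>\<beta> \<le> \<alpha>\<close>.  Hence all the
translates of the set in direction \<open>u\<close> are disjoint from it.\<close>

lemma negligible_two_slopes_apart:
  fixes H :: "('a::euclidean_space \<times> real) set"
  assumes "closed H" and u: "u \<in> Basis" and "\<alpha> < \<beta>"
  shows "negligible {fst p |p x x'. p \<in> lower_face H x \<and> p \<in> lower_face H x' \<and> inner u x \<le> \<alpha> \<and> \<beta> \<le> inner u x'}"
    (is "negligible ?V")
proof (rule negligible_if_compact_subsets_negligible)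
  let ?S = "{z::('a\<times>real)\<times>'a\<times>'a. fst z \<in> lower_face H (fst (snd z))} \<inter> {z. fst z \<in> lower_face H (snd (snd z))}
     \<inter> {z. inner u (fst (snd z)) \<le> \<alpha>} \<inter> {z. \<beta> \<le> inner u (snd (snd z))}"
  have "closed ?S"
    using assms(1) by (intro closed_Int closed_Collect_lower_face closed_Collect_le continuous_intros)
  then have "(\<lambda>z. fst (fst z)) ` ?S \<in> sets borel"
    by (rule borel_continuous_image_closed) (intro continuous_intros)
  also have "(\<lambda>z. fst (fst z)) ` ?S = ?V"
  proof (intro subset_antisym subsetI)
    fix v assume "v \<in> ?V"
    then obtain p x x' where "v = fst p" "(p, x, x') \<in> ?S"
      by auto
    then show "v \<in> (\<lambda>z. fst (fst z)) ` ?S"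
      by (intro image_eqI[of _ _ "(p, x, x')"]) simp_all
  qed (auto, blast)
  finally show "?V \<in> sets lebesgue"
    by auto
next
  fix Z assume Z: "compact Z" "Z \<subseteq> ?V"
  show "negligible Z"
  proof (rule negligible_if_disjoint_copies_nearby[OF Z(1) zero_less_one])
    fix d :: real assume "d > 0"
    define Y where "Y = (+) ((d/2) *\<^sub>R u) ` Z"
    have False if v: "v \<in> Z" "(d/2) *\<^sub>R u + v \<in> Z" for v
    proof -
      have "v \<in> ?V" "(d/2) *\<^sub>R u + v \<in> ?V"
        using v Z(2) by (simp_all only: subsetD)
      then obtain p x p' x' where p: "p \<in> lower_face H x" "v = fst p" "\<beta> \<le> inner u x"
          and p': "p' \<in> lower_face H x'" "(d/2) *\<^sub>R u + v = fst p'" "inner u x' \<le> \<alpha>"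
        by (elim CollectE exE conjE) (rule that)
      have "0 \<le> inner (x' - x) ((d/2) *\<^sub>R u)"
        using slope_mono[OF p(1) p'(1)] p(2) by (simp flip: p'(2))
      then have "0 \<le> (d/2) * (inner u x' - inner u x)"
        by (simp add: inner_diff inner_commute algebra_simps)
      then show False
        using \<open>d > 0\<close> \<open>\<alpha> < \<beta>\<close> p(3) p'(3) by (simp add: zero_le_mult_iff)
    qed
    then have "Y \<inter> Z = {}"
      by (auto simp: Y_def)
    moreover have "Y \<subseteq> (\<Union>z\<in>Z. ball z d)"
    proof -
      have "dist v ((d/2) *\<^sub>R u + v) < d" for v
        using \<open>d > 0\<close> u by (simp add: dist_norm)
      then show ?thesis
        by (auto simp: Y_def)
    qed
    moreover have "Y \<in> lmeasurable"
      unfolding Y_def by (intro lmeasurable_compact compact_translation Z(1))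
    moreover have "measure lebesgue Y = measure lebesgue Z"
      unfolding Y_def by (rule measure_translation)
    ultimately show "\<exists>Y\<in>lmeasurable. Y \<inter> Z = {} \<and> Y \<subseteq> (\<Union>z\<in>Z. ball z d)
                   \<and> 1 * measure lebesgue Z \<le> measure lebesgue Y"
      by (intro bexI[of _ Y] conjI) simp_all
  qed
qed

definition two_slopes :: "('a::euclidean_space \<times> real) set \<Rightarrow> 'a set" where
  "two_slopes H = {fst p |p x x'. p \<in> lower_face H x \<and> p \<in> lower_face H x' \<and> x \<noteq> x'}"

lemma negligible_two_slopes:
  fixes H :: "('a::euclidean_space \<times> real) set"
  assumes "closed H"
  shows "negligible (two_slopes H)"
proof -
  let ?V = "\<lambda>u \<alpha> \<beta>. {fst p |p x x'. p \<in> lower_face H x \<and> p \<in> lower_face H x' \<and> inner u x \<le> \<alpha> \<and> \<beta> \<le> inner u x'}"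
  let ?I = "Basis \<times> {(\<alpha>, \<beta>). \<alpha> \<in> \<rat> \<and> \<beta> \<in> \<rat> \<and> \<alpha> < \<beta>} :: ('a \<times> real \<times> real) set"
  have "?I \<subseteq> Basis \<times> (\<rat> \<times> \<rat>)"
    by auto
  then have "countable ?I"
    by (rule countable_subset) (simp add: countable_rat countable_finite)
  then have neg: "negligible (\<Union>i\<in>?I. ?V (fst i) (fst (snd i)) (snd (snd i)))" (is "negligible ?U")
    by (intro negligible_countable_Union) (auto simp only: imageE SigmaE mem_Collect_eq case_prod_conv fst_conv snd_conv intro!: negligible_two_slopes_apart assms)
  have key: "fst p \<in> ?U"
    if *: "p \<in> lower_face H x" "p \<in> lower_face H x'" "u \<in> Basis" "inner u x < inner u x'" for p x x' u
  proof -
    obtain \<alpha> where \<alpha>: "\<alpha> \<in> \<rat>" "inner u x < \<alpha>" "\<alpha> < inner u x'"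
      using Rats_dense_in_real[OF *(4)] by blast
    obtain \<beta> where \<beta>: "\<beta> \<in> \<rat>" "\<alpha> < \<beta>" "\<beta> < inner u x'"
      using Rats_dense_in_real[OF \<alpha>(3)] by blast
    have "fst p \<in> ?V u \<alpha> \<beta>"
      using * \<alpha> \<beta> by (intro CollectI exI[of _ p] exI[of _ x] exI[of _ x']) auto
    moreover have "(u, \<alpha>, \<beta>) \<in> ?I"
      using * \<alpha> \<beta> by auto
    ultimately show ?thesis
      by (intro UN_I[of "(u, \<alpha>, \<beta>)"]) (simp_all only: fst_conv snd_conv)
  qed
  have "fst p \<in> ?U" if *: "p \<in> lower_face H x" "p \<in> lower_face H x'" "x \<noteq> x'" for p x x'
  proof -
    obtain u where "u \<in> Basis" "inner x u \<noteq> inner x' u"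
      using \<open>x \<noteq> x'\<close> euclidean_eqI by blast
    then have u: "u \<in> Basis" "inner u x < inner u x' \<or> inner u x' < inner u x"
      by (auto simp: inner_commute)
    show ?thesis
      using u(2) key[OF *(1,2) u(1)] key[OF *(2,1) u(1)] by blast
  qed
  then show ?thesis
    unfolding two_slopes_def by (intro negligible_subset[OF neg]) blast
qed

section \<open>Pushing boundary points into their faces\<close>

text \<open>Why pushing with approximate centres is injective: \<open>q\<close> is a centre that is preferred to \<open>q'\<close> for
the slope \<open>x\<close>, and conversely for \<open>x'\<close>.  Since the two combinations lie on the same vertical line,
the functionals of slope \<open>x\<close> and \<open>x'\<close> have the same difference on them.  That difference is
nonnegative as seen from \<open>x\<close> and nonpositive as seen from \<open>x'\<close>, so it vanishes, and so does each of
its two summands.\<close>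

lemma lower_face_if_same_combination:
  assumes p: "p \<in> lower_face H x" and p': "p' \<in> lower_face H x'"
    and q: "slope_fun x q' \<le> slope_fun x q" and q': "slope_fun x' q \<le> slope_fun x' q'"
    and \<eta>: "0 \<le> \<eta>" "\<eta> < 1"
    and eq: "(1 - \<eta>) *\<^sub>R fst p + \<eta> *\<^sub>R fst q = (1 - \<eta>) *\<^sub>R fst p' + \<eta> *\<^sub>R fst q'"
  shows "p' \<in> lower_face H x"
proof -
  let ?w = "(1 - \<eta>) *\<^sub>R p + \<eta> *\<^sub>R q" and ?w' = "(1 - \<eta>) *\<^sub>R p' + \<eta> *\<^sub>R q'"
  have "fst ?w = fst ?w'"
    using eq by simp
  then have "slope_fun x ?w - slope_fun x ?w' = slope_fun x' ?w - slope_fun x' ?w'"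
    by (simp add: slope_fun_def)
  then have "(1 - \<eta>) * (slope_fun x p - slope_fun x p') + \<eta> * (slope_fun x q - slope_fun x q') =
             (1 - \<eta>) * (slope_fun x' p - slope_fun x' p') + \<eta> * (slope_fun x' q - slope_fun x' q')"
    by (simp add: slope_fun_linear algebra_simps)
  moreover have "(1 - \<eta>) * (slope_fun x' p - slope_fun x' p') \<le> 0" "\<eta> * (slope_fun x' q - slope_fun x' q') \<le> 0"
    using p p' q' \<eta> by (auto intro!: mult_nonneg_nonpos simp: lower_face_def)
  moreover have "\<eta> * (slope_fun x q - slope_fun x q') \<ge> 0"
    using q \<eta> by simp
  ultimately have "(1 - \<eta>) * (slope_fun x p - slope_fun x p') \<le> 0"
    by linarith
  then have "slope_fun x p \<le> slope_fun x p'"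
    using \<eta> by (simp add: mult_le_0_iff)
  then show ?thesis
    using p p' by (auto simp: lower_face_def intro: order_trans)
qed

text \<open>The heart of the proof.  The compact set \<open>Q\<close> is the region in which the centres are sought; every
face over \<open>Z\<close> meets it.  The last hypothesis replaces membership in the relative boundary: a segment
of a face that starts in \<open>Q\<close> and reaches a point over \<open>Z\<close> cannot be prolonged beyond it.  The bound \<open>k\<close> keeps
the set of points and slopes over \<open>Z\<close> compact.\<close>

lemma negligible_nonextendable:
  fixes H :: "('a::euclidean_space \<times> real) set"
  assumes H: "closed H" "convex H" and Q: "compact Q" "Q \<subseteq> H" and Z: "compact Z"
    and bdd: "\<And>z. z \<in> Z \<Longrightarrow> \<exists>p x. fst p = z \<and> p \<in> lower_face H x \<and> norm p \<le> k \<and> norm x \<le> k \<and> lower_face H x \<inter> Q \<noteq> {}"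
    and unique: "\<And>p x x'. fst p \<in> Z \<Longrightarrow> p \<in> lower_face H x \<Longrightarrow> p \<in> lower_face H x' \<Longrightarrow> x = x'"
    and nonext: "\<And>p x q e. fst p \<in> Z \<Longrightarrow> p \<in> lower_face H x \<Longrightarrow> q \<in> lower_face H x \<Longrightarrow> q \<in> Q \<Longrightarrow> e > 0
                   \<Longrightarrow> p + e *\<^sub>R (p - q) \<notin> H"
  shows "negligible Z"
proof (cases "Z = {}")
  case False
  then obtain z0 where "z0 \<in> Z"
    by blast
  then have "k \<ge> 0" "Q \<noteq> {}"
    using bdd[of z0] norm_ge_zero order_trans by blast+
  obtain R where R: "R > 0" "\<And>q. q \<in> Q \<Longrightarrow> norm q \<le> R"
    using compact_imp_bounded[OF Q(1)] bounded_pos by blast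
  have "(1/2::real) ^ DIM('a) > 0"
    by simp
  with Z show ?thesis
  proof (rule negligible_if_disjoint_copies_nearby)
    fix d :: real assume "d > 0"
    define \<eta> where "\<eta> = min (1/2) (d / (2 * (k + R)))"
    have \<eta>: "0 < \<eta>" "\<eta> \<le> 1/2" "\<eta> * (k + R) < d"
    proof -
      have "\<eta> * (k + R) \<le> d / (2 * (k + R)) * (k + R)"
        using \<open>k \<ge> 0\<close> R(1) by (intro mult_right_mono) (auto simp: \<eta>_def)
      also have "\<dots> = d / 2"
        using \<open>k \<ge> 0\<close> R(1) by (simp add: nonzero_divide_eq_eq)
      also have "\<dots> < d"
        using \<open>d > 0\<close> by simp
      finally show "\<eta> * (k + R) < d" .
      show "0 < \<eta>"
        using \<open>k \<ge> 0\<close> R(1) \<open>d > 0\<close> by (simp add: \<eta>_def)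
      show "\<eta> \<le> 1/2"
        unfolding \<eta>_def by (rule min.cobounded1)
    qed
    define C where "C = {t::('a \<times> real) \<times> 'a. fst t \<in> lower_face H (snd t) \<and> fst (fst t) \<in> Z
                            \<and> norm (fst t) \<le> k \<and> norm (snd t) \<le> k}"
    have "compact C"
    proof -
      have "C = (cball 0 k \<times> cball 0 k) \<inter> ({t. fst t \<in> lower_face H (snd t)} \<inter> ((\<lambda>t. fst (fst t)) -` Z))"
        by (auto simp: C_def)
      also have "compact \<dots>"
        by (intro compact_Int_closed compact_Times compact_cball closed_Int closed_Collect_lower_face H
              continuous_intros closed_vimage compact_imp_closed Z)
      finally show ?thesis .
    qed
    have C_surj: "\<exists>p x. (p, x) \<in> C \<and> fst p = z" and C_Q: "(p, x) \<in> C \<Longrightarrow> fst p = z \<Longrightarrow> lower_face H x \<inter> Q \<noteq> {}"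
      if z: "z \<in> Z" for z p x
    proof -
      obtain p' x' where *: "fst p' = z" "p' \<in> lower_face H x'" "norm p' \<le> k" "norm x' \<le> k" "lower_face H x' \<inter> Q \<noteq> {}"
        using bdd[OF z] by blast
      then have "(p', x') \<in> C"
        using z by (simp add: C_def)
      then show "\<exists>p x. (p, x) \<in> C \<and> fst p = z"
        using *(1) by blast
      assume "(p, x) \<in> C" "fst p = z"
      then have "p \<in> lower_face H x" "p = p'"
        using lower_face_over_same_point[of p H x p' x'] * by (auto simp: C_def)
      then have "x = x'"
        using unique[of p x x'] * z by simp
      then show "lower_face H x \<inter> Q \<noteq> {}"
        using * by simp
    qed
    \<comment> \<open>Pairs of a point over \<open>Z\<close> and a centre for which pushing ends in \<open>Z\<close> again: their centre misses
      the face, by compactness by at least a fixed amount \<open>\<epsilon>\<close>.\<close>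
    define S where "S = (C \<times> Q) \<inter> {t. (1 - \<eta>) *\<^sub>R fst (fst (fst t)) + \<eta> *\<^sub>R fst (snd t) \<in> Z}"
    have "compact S"
    proof -
      have "S = (C \<times> Q) \<inter> ((\<lambda>t. (1 - \<eta>) *\<^sub>R fst (fst (fst t)) + \<eta> *\<^sub>R fst (snd t)) -` Z)"
        by (auto simp: S_def)
      also have "compact \<dots>"
        by (intro compact_Int_closed compact_Times \<open>compact C\<close> Q closed_vimage compact_imp_closed Z
              continuous_intros)
      finally show ?thesis .
    qed
    have S_pos: "slope_fun x q < slope_fun x p" if "((p, x), q) \<in> S" for p x q
    proof (rule ccontr)
      assume "\<not> slope_fun x q < slope_fun x p"
      have p: "p \<in> lower_face H x" and q: "q \<in> Q" and w: "(1 - \<eta>) *\<^sub>R fst p + \<eta> *\<^sub>R fst q \<in> Z"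
        using that by (auto simp: S_def C_def)
      then have "slope_fun x q = slope_fun x p"
        using \<open>\<not> slope_fun x q < slope_fun x p\<close> Q(2) by (force simp: lower_face_def)
      then have qf: "q \<in> lower_face H x"
        using lower_face_if_slope_fun_eq p q Q(2) by blast
      \<comment> \<open>Pushed towards a point \<open>q\<close> of the face, \<open>p\<close> can be recovered by prolonging the segment from \<open>q\<close>,
        so the pushed point does not lie over \<open>Z\<close>.\<close>
      let ?w = "(1 - \<eta>) *\<^sub>R p + \<eta> *\<^sub>R q"
      have "?w \<in> lower_face H x"
        using convex_lower_face[OF H(2), of x] p qf \<eta> by (auto intro: convexD)
      moreover have "?w + (\<eta> / (1 - \<eta>)) *\<^sub>R (?w - q) = p"
      proof -
        have "?w + (\<eta> / (1 - \<eta>)) *\<^sub>R (?w - q) = ?w + (\<eta> / (1 - \<eta>)) *\<^sub>R ((1 - \<eta>) *\<^sub>R (p - q))"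
          by (simp add: algebra_simps)
        also have "\<dots> = ?w + \<eta> *\<^sub>R (p - q)"
          using \<eta>(2) by simp
        also have "\<dots> = p"
          by (simp add: algebra_simps)
        finally show ?thesis .
      qed
      moreover have "\<eta> / (1 - \<eta>) > 0"
        using \<eta> by simp
      ultimately have "p \<notin> H"
        using nonext[of ?w x q "\<eta> / (1 - \<eta>)"] w qf q by simp
      then show False
        using p by (simp add: lower_face_def)
    qed
    obtain \<epsilon> where \<epsilon>: "\<epsilon> > 0" "\<And>p x q. ((p, x), q) \<in> S \<Longrightarrow> \<epsilon> \<le> slope_fun x p - slope_fun x q"
    proof (cases "S = {}")
      case False
      have "continuous_on S (\<lambda>t. slope_fun (snd (fst t)) (fst (fst t)) - slope_fun (snd (fst t)) (snd t))"
        by (intro continuous_intros)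
      from continuous_attains_inf[OF \<open>compact S\<close> False this]
      obtain t where t: "t \<in> S" "\<And>t'. t' \<in> S \<Longrightarrow> slope_fun (snd (fst t)) (fst (fst t)) - slope_fun (snd (fst t)) (snd t)
          \<le> slope_fun (snd (fst t')) (fst (fst t')) - slope_fun (snd (fst t')) (snd t')"
        by blast
      show ?thesis
      proof
        show "0 < slope_fun (snd (fst t)) (fst (fst t)) - slope_fun (snd (fst t)) (snd t)"
          using S_pos[of "fst (fst t)" "snd (fst t)" "snd t"] t(1) by simp
      qed (use t(2) in fastforce)
    qed (use that[of 1] in auto)
    \<comment> \<open>A centre in \<open>G\<close> this close to the face misses it by at most \<open>(k + 1) \<delta> = \<epsilon> / 2\<close>.\<close>
    define \<delta> where "\<delta> = \<epsilon> / (2 * (k + 1))"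
    have "\<delta> > 0"
      using \<epsilon>(1) \<open>k \<ge> 0\<close> by (simp add: \<delta>_def)
    then have "Q \<subseteq> (\<Union>q\<in>Q. ball q \<delta>)"
      by auto
    then obtain G where G: "G \<subseteq> Q" "finite G" "Q \<subseteq> (\<Union>q\<in>G. ball q \<delta>)"
      using compactE_image[OF Q(1), of Q "\<lambda>q. ball q \<delta>"] by blast
    then have "G \<noteq> {}"
      using \<open>Q \<noteq> {}\<close> by auto
    define g where "g = from_nat_into G"
    have range_g: "range g = G"
      unfolding g_def using \<open>G \<noteq> {}\<close> G(2) by (simp add: countable_finite range_from_nat_into)
    \<comment> \<open>The preferred centre depends on the slope only, which is what makes pushing injective; ties are
      later broken by the least index.\<close>
    define best where "best x i \<longleftrightarrow> (\<forall>q\<in>G. slope_fun x q \<le> slope_fun x (g i))" for x i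
    have ex_best: "\<exists>i. best x i" for x
    proof -
      obtain q where "q \<in> G" "\<And>q'. q' \<in> G \<Longrightarrow> slope_fun x q' \<le> slope_fun x q"
        using finite_imp_compact[OF G(2)] \<open>G \<noteq> {}\<close> continuous_attains_sup[of G "slope_fun x"]
        by (metis continuous_on_finite G(2))
      then show ?thesis
        using range_g unfolding best_def by (metis rangeE)
    qed
    define B where "B i = {fst p |p x. (p, x) \<in> C \<and> best x i}" for i
    have B_borel: "B i \<in> sets lebesgue" for i
    proof -
      have "closed (C \<inter> (\<Inter>q\<in>G. {t. slope_fun (snd t) q \<le> slope_fun (snd t) (g i)}))" (is "closed ?D")
        by (intro closed_Int closed_INT ballI closed_Collect_le continuous_intros compact_imp_closed \<open>compact C\<close>)
      then have "(\<lambda>t. fst (fst t)) ` ?D \<in> sets borel"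
        by (rule borel_continuous_image_closed) (intro continuous_intros)
      also have "(\<lambda>t. fst (fst t)) ` ?D = B i"
        by (force simp: B_def best_def image_iff)
      finally show ?thesis
        by auto
    qed
    define A where "A = disjointed B"
    have A_meas: "A i \<in> sets lebesgue" for i
      using sets.range_disjointed_sets[of B lebesgue] B_borel by (auto simp: A_def)
    have A_B: "A i \<subseteq> B i" for i
      by (simp add: A_def disjointed_subset)
    have A_minimal: "i \<le> j" if "v \<in> A i" "v \<in> B j" for v i j
    proof (rule ccontr)
      assume "\<not> i \<le> j"
      then have "j \<in> {0..<i}"
        by simp
      then show False
        using that unfolding A_def disjointed_def by blast
    qed
    have UN_A: "(\<Union>i. A i) = Z"
    proof -
      have "(\<Union>i. B i) = Z"
        using C_surj ex_best by (fastforce simp: B_def C_def)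
      then show ?thesis
        by (simp add: A_def UN_disjointed_eq)
    qed
    define T where "T i v = (1 - \<eta>) *\<^sub>R v + \<eta> *\<^sub>R fst (g i)" for i v
    define Y where "Y = (\<Union>i. T i ` A i)"
    have T_emeasure: "emeasure lebesgue (T i ` A i) = ennreal ((1 - \<eta>) ^ DIM('a)) * emeasure lebesgue (A i)" for i
      unfolding T_def using \<eta>
      by (simp add: emeasure_lebesgue_affine ennreal_power)
    have T_meas: "T i ` A i \<in> sets lebesgue" for i
      unfolding T_def
      by (intro differentiable_image_in_sets_lebesgue A_meas order_refl derivative_intros)
    have T_disj: "disjoint_family (\<lambda>i. T i ` A i)"
    proof (unfold disjoint_family_on_def, intro ballI impI)
      fix i j :: nat assume "i \<noteq> j"
      have False if *: "z \<in> A i" "z' \<in> A j" "T i z = T j z'" for z z'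
      proof -
        obtain p x where p: "fst p = z" "(p, x) \<in> C" "best x i"
          using * A_B by (fastforce simp: B_def)
        obtain p' x' where p': "fst p' = z'" "(p', x') \<in> C" "best x' j"
          using * A_B by (fastforce simp: B_def)
        have "p' \<in> lower_face H x"
        proof (rule lower_face_if_same_combination)
          show "p \<in> lower_face H x" "p' \<in> lower_face H x'"
            using p p' by (auto simp: C_def)
          show "slope_fun x (g j) \<le> slope_fun x (g i)" "slope_fun x' (g i) \<le> slope_fun x' (g j)"
            using p(3) p'(3) range_g by (auto simp: best_def)
          show "(1 - \<eta>) *\<^sub>R fst p + \<eta> *\<^sub>R fst (g i) = (1 - \<eta>) *\<^sub>R fst p' + \<eta> *\<^sub>R fst (g j)"
            using *(3) p(1) p'(1) by (simp add: T_def)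
        qed (use \<eta> in auto)
        then have "x = x'"
          using unique[of p' x x'] p' by (auto simp: C_def)
        then have "z \<in> B j" "z' \<in> B i"
          using p p' unfolding B_def by blast+
        then have "i \<le> j" "j \<le> i"
          using A_minimal *(1,2) by blast+
        then show False
          using \<open>i \<noteq> j\<close> by simp
      qed
      then show "T i ` A i \<inter> T j ` A j = {}"
        by blast
    qed
    have "emeasure lebesgue Y = (\<Sum>i. emeasure lebesgue (T i ` A i))"
      unfolding Y_def using T_meas T_disj by (intro suminf_emeasure[symmetric]) auto
    also have "\<dots> = ennreal ((1 - \<eta>) ^ DIM('a)) * (\<Sum>i. emeasure lebesgue (A i))"
      by (simp add: T_emeasure)
    also have "(\<Sum>i. emeasure lebesgue (A i)) = emeasure lebesgue Z"
      unfolding UN_A[symmetric] using A_meas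
      by (intro suminf_emeasure) (auto simp: A_def disjoint_family_disjointed)
    finally have emY: "emeasure lebesgue Y = ennreal ((1 - \<eta>) ^ DIM('a)) * emeasure lebesgue Z" .
    have mZ: "Z \<in> lmeasurable"
      by (simp add: Z lmeasurable_compact)
    have Y_lm: "Y \<in> lmeasurable"
    proof (rule fmeasurableI)
      show "Y \<in> sets lebesgue"
        unfolding Y_def using T_meas by blast
      show "emeasure lebesgue Y < \<infinity>"
        using fmeasurableD2[OF mZ]
        by (simp add: emY ennreal_mult_less_top less_top del: emeasure_completion)
    qed
    have "measure lebesgue Y = (1 - \<eta>) ^ DIM('a) * measure lebesgue Z"
      using emY \<eta> by (simp add: measure_def enn2real_mult)
    moreover have "(1/2) ^ DIM('a) \<le> (1 - \<eta>) ^ DIM('a)"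
      using \<eta> by (intro power_mono) auto
    ultimately have meY: "(1/2) ^ DIM('a) * measure lebesgue Z \<le> measure lebesgue Y"
      by (simp add: mult_right_mono)
    have Y_near: "y \<notin> Z \<and> y \<in> (\<Union>z\<in>Z. ball z d)" if y: "y \<in> Y" for y
    proof -
      obtain i z where z: "z \<in> A i" "y = T i z"
        using y by (auto simp: Y_def)
      obtain p x where p: "fst p = z" "(p, x) \<in> C" "best x i"
        using z A_B by (fastforce simp: B_def)
      have gi: "g i \<in> Q"
        using range_g G(1) by auto
      have "z \<in> Z"
        using p by (auto simp: C_def)
      obtain q where q: "q \<in> lower_face H x" "q \<in> Q"
        using C_Q[OF \<open>z \<in> Z\<close> p(2,1)] by blast
      then obtain q' where q': "q' \<in> G" "dist q' q < \<delta>"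
        using G(3) by auto
      have "y \<notin> Z"
      proof
        assume "y \<in> Z"
        then have "((p, x), g i) \<in> S"
          using p gi z by (auto simp: S_def T_def)
        then have "\<epsilon> \<le> slope_fun x p - slope_fun x (g i)"
          by (rule \<epsilon>(2))
        \<comment> \<open>The preferred centre is at least as good as a net point \<open>q'\<close> close to a point \<open>q\<close> of the face.\<close>
        also have "\<dots> \<le> slope_fun x q - slope_fun x q'"
          using p q q' lower_face_slope_fun_eq[of p H x q] by (auto simp: best_def C_def)
        also have "\<dots> \<le> (norm x + 1) * dist q q'"
          using slope_fun_lipschitz[of x q q'] by linarith
        also have "\<dots> \<le> (k + 1) * \<delta>"
          using p(2) q'(2) \<open>k \<ge> 0\<close> by (intro mult_mono) (auto simp: C_def dist_commute)
        also have "\<dots> = \<epsilon> / 2"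
          using \<open>k \<ge> 0\<close> by (simp add: \<delta>_def field_simps)
        finally show False
          using \<epsilon>(1) by simp
      qed
      moreover have "dist z y < d"
      proof -
        have "dist z y = norm (\<eta> *\<^sub>R (fst p - fst (g i)))"
          by (simp add: dist_norm T_def z(2) p(1) algebra_simps)
        also have "\<dots> \<le> \<eta> * (norm (fst p) + norm (fst (g i)))"
          using \<eta> by (simp add: norm_triangle_ineq4)
        also have "\<dots> \<le> \<eta> * (k + R)"
        proof (intro mult_left_mono add_mono)
          show "norm (fst p) \<le> k"
            using p(2) norm_fst_le[of "fst p" "snd p"] by (auto simp: C_def)
          show "norm (fst (g i)) \<le> R"
            using R(2)[OF gi] norm_fst_le[of "fst (g i)" "snd (g i)"] by auto
        qed (use \<eta> in auto)
        finally show ?thesis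
          using \<eta>(3) by simp
      qed
      ultimately show ?thesis
        using \<open>z \<in> Z\<close> by auto
    qed
    show "\<exists>Y\<in>lmeasurable. Y \<inter> Z = {} \<and> Y \<subseteq> (\<Union>z\<in>Z. ball z d)
            \<and> (1/2) ^ DIM('a) * measure lebesgue Z \<le> measure lebesgue Y"
      using Y_lm meY Y_near by blast
  qed
qed simp

section \<open>Relative boundaries of faces\<close>

text \<open>The points of the shadow of a face that some segment of the face, coming from \<open>Q\<close>, passes through.
If \<open>Q\<close> meets the face, and only in relatively interior points, these are the relatively interior
points of the shadow.\<close>

definition extendable :: "('a::euclidean_space \<times> real) set \<Rightarrow> ('a \<times> real) set \<Rightarrow> 'a set" where
  "extendable H Q = {fst p |p x q e. p \<in> lower_face H x \<and> q \<in> lower_face H x \<and> q \<in> Q \<and> e > 0 \<and> p + e *\<^sub>R (p - q) \<in> H}"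

lemma extendable_borel:
  fixes H :: "('a::euclidean_space \<times> real) set"
  assumes H: "closed H" "convex H" and Q: "closed Q"
  shows "extendable H Q \<in> sets borel"
proof -
  define S where "S j = {z::('a\<times>real)\<times>'a\<times>('a\<times>real). fst z \<in> lower_face H (fst (snd z))}
      \<inter> {z. snd (snd z) \<in> lower_face H (fst (snd z))} \<inter> (\<lambda>z. snd (snd z)) -` Q
      \<inter> (\<lambda>z. fst z + (1 / real (Suc j)) *\<^sub>R (fst z - snd (snd z))) -` H" for j
  have "closed (S j)" for j
    unfolding S_def using H Q
    by (intro closed_Int closed_Collect_lower_face closed_vimage continuous_intros)
  then have "(\<lambda>z. fst (fst z)) ` S j \<in> sets borel" for j
    by (rule borel_continuous_image_closed) (intro continuous_intros)
  then have "(\<Union>j. (\<lambda>z. fst (fst z)) ` S j) \<in> sets borel"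
    by (intro sets.countable_UN) auto
  also have "(\<Union>j. (\<lambda>z. fst (fst z)) ` S j) = extendable H Q"
  proof (intro subset_antisym subsetI)
    fix v assume "v \<in> (\<Union>j. (\<lambda>z. fst (fst z)) ` S j)"
    then obtain j p x q where "fst p = v" "(p, x, q) \<in> S j"
      by auto
    then show "v \<in> extendable H Q"
      unfolding extendable_def S_def
      by (intro CollectI exI[of _ p] exI[of _ x] exI[of _ q] exI[of _ "1 / real (Suc j)"]) auto
  next
    fix v assume "v \<in> extendable H Q"
    then obtain p x q e where *: "v = fst p" "p \<in> lower_face H x" "q \<in> lower_face H x" "q \<in> Q" "e > 0"
        "p + e *\<^sub>R (p - q) \<in> H"
      unfolding extendable_def by blast
    obtain j where j: "1 / real (Suc j) < e"
      using nat_approx_posE[OF \<open>e > 0\<close>] by blast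
    \<comment> \<open>By convexity the extension may be shortened to length \<open>1 / Suc j\<close>.\<close>
    let ?t = "1 / real (Suc j) / e"
    have "(1 - ?t) *\<^sub>R p + ?t *\<^sub>R (p + e *\<^sub>R (p - q)) \<in> H"
      using j * H(2) by (intro convexD) (auto simp: lower_face_def field_simps)
    also have "(1 - ?t) *\<^sub>R p + ?t *\<^sub>R (p + e *\<^sub>R (p - q)) = p + (1 / real (Suc j)) *\<^sub>R (p - q)"
    proof -
      have "(1 - ?t) *\<^sub>R p + ?t *\<^sub>R (p + e *\<^sub>R (p - q)) = p + (?t * e) *\<^sub>R (p - q)"
        by (simp only: scaleR_add_right scaleR_diff_left scaleR_one scaleR_scaleR diff_add_cancel flip: add.assoc)
      then show ?thesis
        using \<open>e > 0\<close> by simp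
    qed
    finally have "(p, x, q) \<in> S j"
      using * by (simp add: S_def)
    then show "v \<in> (\<Union>j. (\<lambda>z. fst (fst z)) ` S j)"
      using *(1) by force
  qed
  finally show ?thesis .
qed

lemma negligible_nonextendable_from:
  fixes H :: "('a::euclidean_space \<times> real) set"
  assumes H: "closed H" "convex H" and Q: "compact Q" "Q \<subseteq> H"
  shows "negligible ({fst p |p x. p \<in> lower_face H x \<and> norm p \<le> k \<and> norm x \<le> k \<and> lower_face H x \<inter> Q \<noteq> {}}
           - two_slopes H - extendable H Q)" (is "negligible (?A - _ - _)")
proof (rule negligible_if_compact_subsets_negligible)
  let ?S = "{z::('a\<times>real)\<times>'a\<times>('a\<times>real). fst z \<in> lower_face H (fst (snd z))}
      \<inter> {z. snd (snd z) \<in> lower_face H (fst (snd z))} \<inter> (\<lambda>z. snd (snd z)) -` Q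
      \<inter> {z. norm (fst z) \<le> k} \<inter> {z. norm (fst (snd z)) \<le> k}"
  have "closed ?S"
    using H compact_imp_closed[OF Q(1)]
    by (intro closed_Int closed_Collect_lower_face closed_vimage closed_Collect_le continuous_intros)
  then have "(\<lambda>z. fst (fst z)) ` ?S \<in> sets borel"
    by (rule borel_continuous_image_closed) (intro continuous_intros)
  also have "(\<lambda>z. fst (fst z)) ` ?S = ?A"
  proof (intro subset_antisym subsetI)
    fix v assume "v \<in> ?A"
    then obtain p x q where "v = fst p" "p \<in> lower_face H x" "norm p \<le> k" "norm x \<le> k" "q \<in> lower_face H x" "q \<in> Q"
      by blast
    then show "v \<in> (\<lambda>z. fst (fst z)) ` ?S"
      by (intro image_eqI[of _ _ "(p, x, q)"]) simp_all
  qed (auto, blast)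
  finally have "?A \<in> sets lebesgue"
    by auto
  moreover have "two_slopes H \<in> sets lebesgue"
    using negligible_two_slopes[OF H(1)] by (rule negligible_imp_sets)
  moreover have "extendable H Q \<in> sets lebesgue"
    using extendable_borel[OF H compact_imp_closed[OF Q(1)]] by auto
  ultimately show "?A - two_slopes H - extendable H Q \<in> sets lebesgue"
    by (intro sets.Diff)
next
  fix Z assume Z: "compact Z" "Z \<subseteq> ?A - two_slopes H - extendable H Q"
  show "negligible Z"
  proof (rule negligible_nonextendable[OF H Q Z(1)])
    show "\<exists>p x. fst p = z \<and> p \<in> lower_face H x \<and> norm p \<le> k \<and> norm x \<le> k \<and> lower_face H x \<inter> Q \<noteq> {}" if "z \<in> Z" for z
      using Z(2) that by blast
    show "x = x'" if "fst p \<in> Z" "p \<in> lower_face H x" "p \<in> lower_face H x'" for p x x'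
      using Z(2) that unfolding two_slopes_def by blast
    show "p + e *\<^sub>R (p - q) \<notin> H" if "fst p \<in> Z" "p \<in> lower_face H x" "q \<in> lower_face H x" "q \<in> Q" "e > 0" for p x q e
      using Z(2) that unfolding extendable_def by blast
  qed
qed

text \<open>Near a relatively interior point of the shadow of a face, some ball from a countable family meets
the shadow, and does so in relatively interior points only.  From such points a relative boundary
point of the shadow is not extendable, so it is caught by one of countably many null sets.\<close>

theorem negligible_relative_boundaries_of_lower_faces:
  fixes H :: "('a::euclidean_space \<times> real) set"
  assumes H: "closed H" "convex H"
  shows "negligible {fst p |p x. p \<in> lower_face H x \<and> fst p \<notin> rel_interior (fst ` lower_face H x)}"
proof -
  obtain D :: "'a set" where D: "countable D" "\<And>X. open X \<Longrightarrow> X \<noteq> {} \<Longrightarrow> \<exists>r\<in>D. r \<in> X"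
    using countable_dense_setE by blast
  \<comment> \<open>Boxing the heights makes these sets compact.\<close>
  define Q where "Q r j k = H \<inter> (cball r (1 / real (Suc j)) \<times> {- real k..real k})" for r :: 'a and j k :: nat
  have Q: "compact (Q r j k)" "Q r j k \<subseteq> H" for r j k
    unfolding Q_def by (intro closed_Int_compact H compact_Times compact_cball compact_Icc) blast
  define N where "N r j k = {fst p |p x. p \<in> lower_face H x \<and> norm p \<le> real k \<and> norm x \<le> real k \<and> lower_face H x \<inter> Q r j k \<noteq> {}}
           - two_slopes H - extendable H (Q r j k)" for r j k
  have "negligible (N r j k)" for r j k
    unfolding N_def using H Q by (rule negligible_nonextendable_from)
  then have "negligible (\<Union>r\<in>D. \<Union>j. \<Union>k. N r j k)"
    using D(1) by (intro negligible_countable_Union) (auto intro!: negligible_countable_Union)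
  moreover have "negligible (two_slopes H)"
    using H(1) by (rule negligible_two_slopes)
  ultimately have neg: "negligible (two_slopes H \<union> (\<Union>r\<in>D. \<Union>j. \<Union>k. N r j k))"
    by (intro negligible_Un)
  have "fst p \<in> (\<Union>r\<in>D. \<Union>j. \<Union>k. N r j k)"
    if p: "p \<in> lower_face H x" and bad: "fst p \<notin> rel_interior (fst ` lower_face H x)" and one: "fst p \<notin> two_slopes H" for p x
  proof -
    let ?F = "fst ` lower_face H x"
    have conv: "convex ?F"
      by (intro convex_linear_image convex_lower_face H linear_fst)
    then obtain c where c: "c \<in> rel_interior ?F"
      using p rel_interior_eq_empty by blast
    then obtain e where e: "e > 0" "ball c e \<inter> ?F \<subseteq> rel_interior ?F"
    proof -
      obtain U where U: "open U" "rel_interior ?F = affine hull ?F \<inter> U"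
        using openin_rel_interior[of ?F] unfolding openin_open by blast
      then obtain e where "e > 0" "ball c e \<subseteq> U"
        using c open_contains_ball by blast
      then show thesis
        using that[of e] U(2) hull_subset[of ?F affine] by blast
    qed
    obtain s where s: "(c, s) \<in> lower_face H x"
      using c rel_interior_subset[of ?F] by force
    obtain j where j: "1 / real (Suc j) < e / 2"
      using nat_approx_posE[of "e/2"] \<open>e > 0\<close> by auto
    obtain r where r: "r \<in> D" "dist c r < 1 / real (Suc j)"
      using D(2)[of "ball c (1 / real (Suc j))"] by auto
    obtain k :: nat where k: "max (norm p) (max (norm x) \<bar>s\<bar>) \<le> real k"
      using real_arch_simple by blast
    have "(c, s) \<in> lower_face H x \<inter> Q r j k"
      using s r(2) k by (auto simp: Q_def lower_face_def dist_commute)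
    moreover have "fst p \<notin> extendable H (Q r j k)"
    proof
      assume "fst p \<in> extendable H (Q r j k)"
      then obtain p' x' q t where *: "fst p = fst p'" "p' \<in> lower_face H x'" "q \<in> lower_face H x'" "q \<in> Q r j k" "t > 0"
          "p' + t *\<^sub>R (p' - q) \<in> H"
        unfolding extendable_def by blast
      have "p' = p"
        using lower_face_over_same_point[OF *(2) p] *(1) by simp
      then have "x' = x"
        using one p *(2) unfolding two_slopes_def by blast
      note * = *[unfolded \<open>p' = p\<close> \<open>x' = x\<close>]
      let ?y = "p + t *\<^sub>R (p - q)"
      have "?y \<in> lower_face H x"
        using lower_face_if_slope_fun_eq[OF p *(6)] lower_face_slope_fun_eq[OF p *(3)] by (simp add: slope_fun_linear)
      have "dist c (fst q) < e"
        using *(4) r(2) j dist_triangle[of c "fst q" r] by (auto simp: Q_def)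
      then have q: "fst q \<in> rel_interior ?F"
        using e(2) *(3) by auto
      \<comment> \<open>\<open>fst p\<close> lies strictly between the relatively interior point \<open>fst q\<close> and \<open>fst ?y\<close>.\<close>
      have "fst ?y - (t / (1 + t)) *\<^sub>R (fst ?y - fst q) \<in> rel_interior ?F"
        using imageI[OF \<open>?y \<in> lower_face H x\<close>, of fst] \<open>t > 0\<close>
        by (intro rel_interior_convex_shrink conv q) simp_all
      moreover have "fst ?y - (t / (1 + t)) *\<^sub>R (fst ?y - fst q) = fst p"
      proof -
        have "fst ?y - fst q = (1 + t) *\<^sub>R (fst p - fst q)"
          by (simp add: algebra_simps)
        then show ?thesis
          using \<open>t > 0\<close> by simp
      qed
      ultimately show False
        using bad by simp
    qed
    moreover have "norm p \<le> real k" "norm x \<le> real k"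
      using k by auto
    ultimately have "fst p \<in> N r j k"
      using p one unfolding N_def by blast
    then show ?thesis
      using r(1) by blast
  qed
  then show ?thesis
    by (intro negligible_subset[OF neg]) blast
qed

section \<open>The epigraph of the conjugate and tilted minimization\<close>

text \<open>The epigraph of the conjugate \<open>v \<mapsto> sup\<^sub>y (\<langle>v,y\<rangle> - f y)\<close>, described as an intersection of
half-spaces: closedness and convexity are then immediate, and infinite values need no care.\<close>

definition conjugate_epigraph :: "('a::euclidean_space \<Rightarrow> ereal) \<Rightarrow> ('a \<times> real) set" where
  "conjugate_epigraph f = {p. \<forall>y. ereal (slope_fun y p) \<le> f y}"

lemma closed_convex_conjugate_epigraph:
  fixes f :: "'a::euclidean_space \<Rightarrow> ereal"
  shows "closed (conjugate_epigraph f)" "convex (conjugate_epigraph f)"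
proof -
  have eq: "conjugate_epigraph f = (\<Inter>y. {p. ereal (slope_fun y p) \<le> f y})"
    by (auto simp: conjugate_epigraph_def)
  have slope_fun_inner: "slope_fun y p = inner (y, -1) p" for y :: 'a and p
    by (simp add: slope_fun_def inner_prod_def)
  have "closed {p. ereal (slope_fun y p) \<le> f y} \<and> convex {p. ereal (slope_fun y p) \<le> f y}" for y
    by (cases "f y") (simp_all add: slope_fun_inner closed_halfspace_le convex_halfspace_le)
  then show "closed (conjugate_epigraph f)" "convex (conjugate_epigraph f)"
    unfolding eq by (auto intro!: closed_INT convex_INT)
qed

text \<open>By definition of the conjugate, \<open>f x\<close> bounds the functional of slope \<open>x\<close> on its epigraph.\<close>

lemma lower_face_conjugate_epigraph:
  assumes "f x = ereal a" and p: "p \<in> conjugate_epigraph f" "slope_fun x p = a"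
  shows "p \<in> lower_face (conjugate_epigraph f) x"
proof -
  have "slope_fun x q \<le> a" if "q \<in> conjugate_epigraph f" for q
  proof -
    have "ereal (slope_fun x q) \<le> f x"
      using that by (simp add: conjugate_epigraph_def)
    then show ?thesis
      using assms(1) by simp
  qed
  then show ?thesis
    using p by (simp add: lower_face_def)
qed

lemma minimizer_tiltD:
  fixes f :: "'a::euclidean_space \<Rightarrow> ereal"
  assumes "proper_fun f" and min: "minimizer (tilt f v) x"
  obtains a where "f x = ereal a" "(v, inner v x - a) \<in> lower_face (conjugate_epigraph f) x"
proof -
  have le: "f x - ereal (inner v x) \<le> f y - ereal (inner v y)" for y
    using min by (auto simp: minimizer_def tilt_def is_arg_min_def not_less)
  obtain y0 where "f y0 \<noteq> \<infinity>"
    using assms(1) by (auto simp: proper_fun_def)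
  moreover have "f x \<noteq> - \<infinity>" "f y0 \<noteq> - \<infinity>"
    using assms(1) by (auto simp: proper_fun_def)
  ultimately obtain a where a: "f x = ereal a"
    using le[of y0] by (cases "f x"; cases "f y0") auto
  have "ereal (inner y v - (inner v x - a)) \<le> f y" for y
    using le[of y] a by (cases "f y") (auto simp: inner_commute)
  then have "(v, inner v x - a) \<in> conjugate_epigraph f"
    by (simp add: conjugate_epigraph_def slope_fun_def)
  then have "(v, inner v x - a) \<in> lower_face (conjugate_epigraph f) x"
    using a by (intro lower_face_conjugate_epigraph) (auto simp: slope_fun_def inner_commute)
  then show thesis
    using a that by blast
qed

lemma subdifferential_tilt_eq:
  fixes f :: "'a::euclidean_space \<Rightarrow> ereal"
  assumes a: "f x = ereal a" and v: "(v, inner v x - a) \<in> lower_face (conjugate_epigraph f) x"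
  shows "subdifferential (tilt f v) x = (+) (- v) ` fst ` lower_face (conjugate_epigraph f) x"
proof -
  have ineq: "ereal (inner w (y - x)) \<le> tilt f v y - tilt f v x \<longleftrightarrow>
      ereal (slope_fun y (v + w, inner (v + w) x - a)) \<le> f y" for w y
    by (cases "f y") (auto simp: tilt_def a slope_fun_def algebra_simps inner_commute)
  have "w \<in> subdifferential (tilt f v) x \<longleftrightarrow> v + w \<in> fst ` lower_face (conjugate_epigraph f) x" for w
  proof -
    have "w \<in> subdifferential (tilt f v) x \<longleftrightarrow> (v + w, inner (v + w) x - a) \<in> conjugate_epigraph f"
      using ineq by (simp add: subdifferential_def conjugate_epigraph_def) (simp add: tilt_def a)
    also have "\<dots> \<longleftrightarrow> v + w \<in> fst ` lower_face (conjugate_epigraph f) x"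
    proof
      assume "(v + w, inner (v + w) x - a) \<in> conjugate_epigraph f"
      then have "(v + w, inner (v + w) x - a) \<in> lower_face (conjugate_epigraph f) x"
        using a by (intro lower_face_conjugate_epigraph) (auto simp: slope_fun_def inner_commute)
      then show "v + w \<in> fst ` lower_face (conjugate_epigraph f) x"
        by (rule rev_image_eqI) simp
    next
      assume "v + w \<in> fst ` lower_face (conjugate_epigraph f) x"
      then obtain s where s: "(v + w, s) \<in> lower_face (conjugate_epigraph f) x"
        by auto
      then have "s = inner (v + w) x - a"
        using lower_face_slope_fun_eq[OF s v] by (simp add: slope_fun_def inner_commute)
      then show "(v + w, inner (v + w) x - a) \<in> conjugate_epigraph f"
        using s by (simp add: lower_face_def)
    qed
    finally show ?thesis .
  qed
  then show ?thesis
    by (force simp: image_iff)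
qed

theorem corollary3p5:
  fixes f :: "real ^ 'n \<Rightarrow> ereal"
  assumes "proper_fun f" and "convex_fun f"
  shows "AE v in lebesgue.
           (\<exists>\<^sub>\<le>\<^sub>1x. minimizer (tilt f v) x) \<and>
           (\<forall>x. minimizer (tilt f v) x \<longrightarrow> nondegenerate_at (tilt f v) x)"
proof -
  let ?H = "conjugate_epigraph f"
  let ?N = "{fst p |p x. p \<in> lower_face ?H x \<and> fst p \<notin> rel_interior (fst ` lower_face ?H x)}"
  have "negligible (two_slopes ?H \<union> ?N)"
    by (intro negligible_Un negligible_two_slopes negligible_relative_boundaries_of_lower_faces
          closed_convex_conjugate_epigraph)
  then have "two_slopes ?H \<union> ?N \<in> null_sets lebesgue"
    by (simp add: negligible_iff_null_sets)
  then show ?thesis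
  proof (rule AE_I', intro subsetI)
    fix v assume "v \<in> {v \<in> space lebesgue. \<not> ((\<exists>\<^sub>\<le>\<^sub>1x. minimizer (tilt f v) x) \<and>
           (\<forall>x. minimizer (tilt f v) x \<longrightarrow> nondegenerate_at (tilt f v) x))}"
    then consider x x' where "minimizer (tilt f v) x" "minimizer (tilt f v) x'" "x \<noteq> x'"
      | x where "minimizer (tilt f v) x" "\<not> nondegenerate_at (tilt f v) x"
      unfolding Uniq_def by blast
    then show "v \<in> two_slopes ?H \<union> ?N"
    proof cases
      case 1
      obtain a where a: "(v, inner v x - a) \<in> lower_face ?H x"
        using minimizer_tiltD[OF assms(1) 1(1)] by blast
      obtain a' where a': "(v, inner v x' - a') \<in> lower_face ?H x'"
        using minimizer_tiltD[OF assms(1) 1(2)] by blast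
      have "(v, inner v x - a) = (v, inner v x' - a')"
        by (rule lower_face_over_same_point[OF a a']) simp
      then have "\<exists>p. v = fst p \<and> p \<in> lower_face ?H x \<and> p \<in> lower_face ?H x'"
        using a a' by (metis fst_conv)
      then show ?thesis
        using 1(3) unfolding two_slopes_def by blast
    next
      case 2
      obtain a where a: "f x = ereal a" "(v, inner v x - a) \<in> lower_face ?H x"
        using minimizer_tiltD[OF assms(1) 2(1)] by blast
      have "v \<notin> rel_interior (fst ` lower_face ?H x)"
      proof
        assume "v \<in> rel_interior (fst ` lower_face ?H x)"
        then have "- v + v \<in> rel_interior (subdifferential (tilt f v) x)"
          unfolding subdifferential_tilt_eq[OF a] rel_interior_translation by (rule imageI)
        then show False
          using 2(2) by (simp add: nondegenerate_at_def)
      qed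
      then have "v \<in> ?N"
        using a(2) by (intro CollectI exI[of _ "(v, inner v x - a)"] exI[of _ x]) simp
      then show ?thesis ..
    qed
  qed
qed

end
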